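(* Let $p$ be an odd prime, let $n\ge 1$ be an integer, and let $a,b,c$ be nonnegative integers. (i) Assume that $$p-1\le a+b+(n-1)c,\qquad a+b+(2n-2)c<2p-1 .$$ Then in $\mathbb F_p$ $$\int_{[1,\dots,1]_p}\prod_{1\le i<j\le n}(x_i-x_j)^{2c}\prod_{i=1}^n x_i^a(1-x_i)^b\,dx_1\cdots dx_n=(-1)^n\prod_{j=1}^n\frac{(jc)!}{c!}\,\frac{(a+(j-1)c)!\,(b+(j-1)c)!}{(a+b+(n+j-2)c+1-p)!}.$$ (ii) If $k\in\{1,\dots,n-1\}$ and $$p-1\le a+b+(n-1)c,\qquad a+b+(2n-2)c<2p-2,$$ then in $\mathbb F_p$ $$\int_{[1,\dots,1]_p}\prod_{i=1}^k x_i\prod_{1\le i<j\le n}(x_i-x_j)^{2c}\prod_{i=1}^n x_i^a(1-x_i)^b\,dx_1\cdots dx_n$$ $$=(-1)^n\prod_{j=1}^k\frac{a+(n-j)c+1}{a+b+(2n-j-1)c+2}\ \prod_{j=1}^n\frac{(jc)!}{c!}\,\frac{(a+(j-1)c)!\,(b+(j-1)c)!}{(a+b+(n+j-2)c+1-p)!}.$$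
   Context: For a polynomial $P(x_1,\dots,x_n)$ with coefficients in $\mathbb F_p$ (integer coefficients being reduced modulo $p$), the $\mathbb F_p$-integral $\int_{[1,\dots,1]_p}P(x_1,\dots,x_n)\,dx_1\cdots dx_n\in\mathbb F_p$ is by definition the coefficient of $x_1^{p-1}\cdots x_n^{p-1}$ in $P$. On the right-hand sides, each $\frac{(jc)!}{c!}$ is the (integer) ratio projected to $\mathbb F_p$; the other factors are integers projected to $\mathbb F_p$, with division in $\mathbb F_p$. *)

theory Defs
  imports "Berlekamp_Zassenhaus.Finite_Field" "HOL-Library.Poly_Mapping"
begin

(* Polynomials over F_p in the variables x_1, x_2, ...: finitely supported maps from exponent
   vectors (finitely supported nat => nat) to F_p, with convolution as multiplication. *)
type_synonym 'p Fp_mpoly = "(nat \<Rightarrow>\<^sub>0 nat) \<Rightarrow>\<^sub>0 'p mod_ring"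

definition Var :: "nat \<Rightarrow> 'p::prime_card Fp_mpoly" where
  "Var i = Poly_Mapping.single (Poly_Mapping.single i 1) 1"

(* The integral over [1,...,1]_p of a polynomial in x_1, ..., x_n; the prime p is CARD('p). *)
definition Fp_integral :: "nat \<Rightarrow> 'p::prime_card Fp_mpoly \<Rightarrow> 'p mod_ring" where
  "Fp_integral n P = Poly_Mapping.lookup P (\<Sum>i=1..n. Poly_Mapping.single i (CARD('p) - 1))"

definition Selberg_integrand :: "nat \<Rightarrow> nat \<Rightarrow> nat \<Rightarrow> nat \<Rightarrow> 'p::prime_card Fp_mpoly" where
  "Selberg_integrand n a b c =
     (\<Prod>(i, j)\<in>{(i, j). 1 \<le> i \<and> i < j \<and> j \<le> n}. (Var i - Var j) ^ (2 * c)) *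
     (\<Prod>i=1..n. Var i ^ a * (1 - Var i) ^ b)"

(* (jc)!/c! is divided in the integers before reduction modulo p.  The natural number subtractions
   are exact when n >= 1 and p - 1 <= a + b + (n - 1) c. *)
definition Selberg_product ::
    "nat \<Rightarrow> nat \<Rightarrow> nat \<Rightarrow> nat \<Rightarrow> 'p::prime_card mod_ring" where
  "Selberg_product n a b c =
     (\<Prod>j=1..n.
        of_nat (fact (j * c) div fact c) *
        (of_nat (fact (a + (j - 1) * c)) * of_nat (fact (b + (j - 1) * c)) /
         of_nat (fact (a + b + (n + j - 2) * c + 1 - CARD('p)))))"

end

(* Writing I_k for the coefficient of x_1^N ... x_n^N in x_1 ... x_k times the integrand, Aomoto's
   argument expands N [H] = [x_1 d/dx_1 H] for H = (1 - x_1) x_2 ... x_k times the integrand; after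
   symmetrizing over transpositions it relates I_(k-1) and I_k over any integral domain.  In F_p with
   N = p - 1 this reduces (ii) to (i).  Over the integers, one full round k = 1, ..., n lowers N by one,
   which reduces I_0 to the lowest coefficient, Dyson's constant term in n variables; setting
   x_(n+1) = 1 turns Dyson's constant term in n + 1 variables into an I_0 in n variables, and
   induction on n yields Morris' identity.  Reducing it modulo p and rewriting the factorials
   (p - 1 - m)! by Wilson's theorem as (-1)^(m+1) / m! gives (i).  If a + (n - 1) c > p - 1, both sides
   of (i) vanish. *)

theory Submission
  imports Defs "HOL-Combinatorics.Transposition"
begin

type_synonym 'a mpoly = "(nat \<Rightarrow>\<^sub>0 nat) \<Rightarrow>\<^sub>0 'a"

abbreviation lookup where "lookup \<equiv> Poly_Mapping.lookup"
abbreviation keys where "keys \<equiv> Poly_Mapping.keys"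
abbreviation single where "single \<equiv> Poly_Mapping.single"

section \<open>Polynomial maps induced by maps of exponents and coefficients\<close>

lemma poly_mapping_sum_single: "(\<Sum>k\<in>keys p. single k (lookup p k)) = p"
proof (rule poly_mapping_eqI)
  fix k
  have "lookup (\<Sum>k\<in>keys p. single k (lookup p k)) k = (\<Sum>l\<in>keys p. if l = k then lookup p l else 0)"
    by (simp add: lookup_sum lookup_single when_def)
  also have "\<dots> = lookup p k"
    by (simp add: sum.delta' in_keys_iff)
  finally show "lookup (\<Sum>k\<in>keys p. single k (lookup p k)) k = lookup p k" .
qed

lemma poly_mapping_induct [case_names zero single add]:
  fixes p :: "'k \<Rightarrow>\<^sub>0 'a::comm_monoid_add"
  assumes "P 0" "\<And>k v. P (single k v)" "\<And>p q. P p \<Longrightarrow> P q \<Longrightarrow> P (p + q)"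
  shows "P p"
proof -
  have "P (\<Sum>k\<in>A. single k (lookup p k))" if "finite A" for A
    using that by (induction A) (auto intro: assms)
  from this[of "keys p"] show ?thesis
    by (simp add: poly_mapping_sum_single)
qed

text \<open>One construction serves three purposes: transposing variables, setting a variable to 1,
  and reducing coefficients modulo p. Where \<open>\<phi>\<close> identifies monomials, their
  coefficients are added.\<close>

definition push :: "('k \<Rightarrow> 'l) \<Rightarrow> ('a::zero \<Rightarrow> 'b::comm_monoid_add) \<Rightarrow> ('k \<Rightarrow>\<^sub>0 'a) \<Rightarrow> ('l \<Rightarrow>\<^sub>0 'b)" where
  "push \<phi> h p = (\<Sum>k\<in>keys p. single (\<phi> k) (h (lookup p k)))"

text \<open>Injectivity is asked only at \<open>k0\<close> and only among the monomials of
  \<open>p\<close>, so that the lemma also serves for the map that forgets one exponent.\<close>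

lemma lookup_push:
  assumes "\<And>k. k \<in> keys p \<Longrightarrow> \<phi> k = \<phi> k0 \<Longrightarrow> k = k0" and "h 0 = 0"
  shows "lookup (push \<phi> h p) (\<phi> k0) = h (lookup p k0)"
proof -
  have "lookup (push \<phi> h p) (\<phi> k0) = (\<Sum>k\<in>keys p. if k = k0 then h (lookup p k) else 0)"
    unfolding push_def lookup_sum
    by (rule sum.cong) (use assms(1) in \<open>auto simp: lookup_single when_def\<close>)
  also have "\<dots> = h (lookup p k0)"
    by (auto simp: in_keys_iff assms(2))
  finally show ?thesis .
qed

locale push_hom =
  fixes \<phi> :: "'k::comm_monoid_add \<Rightarrow> 'l::comm_monoid_add"
    and h :: "'a::comm_ring_1 \<Rightarrow> 'b::comm_ring_1"
  assumes phi_0: "\<phi> 0 = 0" and phi_add: "\<phi> (k + l) = \<phi> k + \<phi> l"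
    and h_0: "h 0 = 0" and h_1: "h 1 = 1"
    and h_add: "h (x + y) = h x + h y" and h_mult: "h (x * y) = h x * h y"
begin

lemma push_zero: "push \<phi> h 0 = 0"
  by (simp add: push_def)

lemma push_single: "push \<phi> h (single k v) = single (\<phi> k) (h v)"
  by (simp add: push_def h_0)

lemma push_one: "push \<phi> h 1 = 1"
  by (simp add: push_single phi_0 h_1 flip: single_one)

lemma push_superset:
  assumes "finite A" "keys p \<subseteq> A"
  shows "push \<phi> h p = (\<Sum>k\<in>A. single (\<phi> k) (h (lookup p k)))"
  unfolding push_def using assms
  by (intro sum.mono_neutral_left) (auto simp: in_keys_iff h_0)

lemma push_add: "push \<phi> h (p + q) = push \<phi> h p + push \<phi> h q"
proof -
  let ?A = "keys p \<union> keys q"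
  have "push \<phi> h r = (\<Sum>k\<in>?A. single (\<phi> k) (h (lookup r k)))" if "keys r \<subseteq> ?A" for r
    using that by (intro push_superset) auto
  then show ?thesis
    using keys_add[of p q]
    by (simp add: lookup_add h_add single_add sum.distrib)
qed

lemma push_uminus: "push \<phi> h (- p) = - push \<phi> h p"
  using push_add[of p "- p"] by (simp add: push_zero minus_unique)

lemma push_diff: "push \<phi> h (p - q) = push \<phi> h p - push \<phi> h q"
  using push_add[of p "- q"] by (simp add: push_uminus)

text \<open>Both sides are additive in each factor, which leaves the case of two monomials.\<close>

lemma push_mult: "push \<phi> h (p * q) = push \<phi> h p * push \<phi> h q"
proof (induction p rule: poly_mapping_induct)
  case (single k v)
  show ?case
  proof (induction q rule: poly_mapping_induct)
    case (single l w)
    show ?case by (simp add: mult_single push_single phi_add h_mult)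
  qed (simp_all add: push_zero push_add distrib_left)
qed (simp_all add: push_zero push_add distrib_right)

lemma push_power: "push \<phi> h (p ^ n) = push \<phi> h p ^ n"
  by (induction n) (simp_all add: push_one push_mult)

lemma push_prod: "push \<phi> h (\<Prod>s\<in>S. f s) = (\<Prod>s\<in>S. push \<phi> h (f s))"
  by (induction S rule: infinite_finite_induct) (simp_all add: push_one push_mult)

lemmas push_simps = push_single push_one push_diff push_mult push_power push_prod

end

section \<open>The Euler operator x_i d/dx_i\<close>

definition euler :: "nat \<Rightarrow> 'a::comm_ring_1 mpoly \<Rightarrow> 'a mpoly" where
  "euler i p = Poly_Mapping.mapp (\<lambda>k v. of_nat (lookup k i) * v) p"

lemma lookup_euler: "lookup (euler i p) k = of_nat (lookup k i) * lookup p k"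
  by (simp add: euler_def lookup_mapp when_def in_keys_iff)

lemma euler_add: "euler i (p + q) = euler i p + euler i q"
  by (rule poly_mapping_eqI) (simp add: lookup_euler lookup_add distrib_left)

lemma euler_diff: "euler i (p - q) = euler i p - euler i q"
  by (rule poly_mapping_eqI) (simp add: lookup_euler lookup_minus right_diff_distrib)

lemma euler_zero [simp]: "euler i 0 = 0"
  by (rule poly_mapping_eqI) (simp add: lookup_euler)

lemma euler_one [simp]: "euler i 1 = 0"
  by (rule poly_mapping_eqI) (simp add: lookup_euler lookup_one when_def)

lemma euler_single: "euler i (single k v) = single k (of_nat (lookup k i) * v)"
  by (rule poly_mapping_eqI) (simp add: lookup_euler lookup_single when_def)

lemma euler_mult: "euler i (p * q) = euler i p * q + p * euler i q"
proof (induction p rule: poly_mapping_induct)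
  case (single k v)
  show ?case
  proof (induction q rule: poly_mapping_induct)
    case (single l w)
    show ?case
      by (simp add: mult_single euler_single lookup_add algebra_simps flip: single_add)
  qed (simp_all add: euler_add distrib_left)
qed (simp_all add: euler_add distrib_right)

text \<open>At \<open>m = 0\<close> the truncated exponent is harmless, as the factor
  \<open>of_nat m\<close> vanishes.\<close>

lemma euler_power: "euler i (p ^ m) = of_nat m * p ^ (m - 1) * euler i p"
proof (induction m)
  case (Suc m)
  then show ?case
    by (cases m) (simp_all add: euler_mult algebra_simps)
qed simp

lemma euler_prod:
  "finite S \<Longrightarrow> euler i (\<Prod>s\<in>S. f s) = (\<Sum>s\<in>S. euler i (f s) * (\<Prod>t\<in>S - {s}. f t))"
proof (induction S rule: finite_induct)
  case (insert x S)
  have "(\<Prod>t\<in>insert x S - {s}. f t) = f x * (\<Prod>t\<in>S - {s}. f t)" if "s \<in> S" for s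
  proof -
    have "insert x S - {s} = insert x (S - {s})"
      using that insert.hyps by auto
    then show ?thesis using insert.hyps by simp
  qed
  then have "(\<Sum>s\<in>S. euler i (f s) * (\<Prod>t\<in>insert x S - {s}. f t))
      = f x * (\<Sum>s\<in>S. euler i (f s) * (\<Prod>t\<in>S - {s}. f t))"
    by (simp add: sum_distrib_left mult_ac)
  moreover have "insert x S - {x} = S"
    using insert.hyps by auto
  ultimately show ?case
    using insert by (simp add: euler_mult)
qed simp

lemma euler_prod_eq_0: "(\<And>s. s \<in> S \<Longrightarrow> euler i (f s) = 0) \<Longrightarrow> euler i (\<Prod>s\<in>S. f s) = 0"
  by (induction S rule: infinite_finite_induct) (simp_all add: euler_mult)

definition mvar :: "nat \<Rightarrow> 'a::comm_ring_1 mpoly" where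
  "mvar i = single (single i 1) 1"

lemma euler_mvar: "euler i (mvar j) = (if i = j then mvar j else 0)"
  by (simp add: mvar_def euler_single lookup_single when_def)

section \<open>Coefficient extraction and the Selberg integrand\<close>

definition box :: "nat \<Rightarrow> nat \<Rightarrow> (nat \<Rightarrow>\<^sub>0 nat)" where
  "box n N = (\<Sum>i=1..n. single i N)"

lemma lookup_box: "lookup (box n N) i = (if i \<in> {1..n} then N else 0)"
  by (auto simp: box_def lookup_sum lookup_single when_def)

abbreviation coef :: "nat \<Rightarrow> nat \<Rightarrow> 'a::comm_ring_1 mpoly \<Rightarrow> 'a" where
  "coef n N p \<equiv> lookup p (box n N)"

lemma lookup_of_nat_mult: "lookup (of_nat m * p) k = of_nat m * lookup p k"
  for p :: "'a::comm_ring_1 mpoly"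
  by (induction m) (simp_all add: lookup_add distrib_right)

text \<open>This replaces integration by parts: the Euler operator keeps every exponent vector, and
  x_i has exponent N in the extracted monomial.\<close>

lemma coef_euler: "i \<in> {1..n} \<Longrightarrow> coef n N (euler i p) = of_nat N * coef n N p"
  by (simp add: lookup_euler lookup_box)

definition pairs :: "nat \<Rightarrow> (nat \<times> nat) set" where
  "pairs n = {(i, j). 1 \<le> i \<and> i < j \<and> j \<le> n}"

lemma finite_pairs [simp]: "finite (pairs n)"
  by (rule finite_subset[of _ "{1..n} \<times> {1..n}"]) (auto simp: pairs_def)

lemma mem_pairs: "(i, j) \<in> pairs n \<longleftrightarrow> 1 \<le> i \<and> i < j \<and> j \<le> n"
  by (simp add: pairs_def)

definition disc :: "nat \<Rightarrow> nat \<Rightarrow> 'a::comm_ring_1 mpoly" where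
  "disc n c = (\<Prod>(i, j)\<in>pairs n. (mvar i - mvar j) ^ (2 * c))"

definition weight :: "nat \<Rightarrow> nat \<Rightarrow> nat \<Rightarrow> 'a::comm_ring_1 mpoly" where
  "weight n a b = (\<Prod>i=1..n. mvar i ^ a * (1 - mvar i) ^ b)"

definition sel :: "nat \<Rightarrow> nat \<Rightarrow> nat \<Rightarrow> nat \<Rightarrow> 'a::comm_ring_1 mpoly" where
  "sel n a b c = disc n c * weight n a b"

lemma Selberg_integrand_eq_sel: "Selberg_integrand = (sel :: _ \<Rightarrow> _ \<Rightarrow> _ \<Rightarrow> _ \<Rightarrow> 'p::prime_card Fp_mpoly)"
  by (intro ext) (simp add: Selberg_integrand_def sel_def disc_def weight_def pairs_def Var_def mvar_def)

section \<open>Symmetry under transpositions of the variables\<close>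

definition vswap :: "nat \<Rightarrow> nat \<Rightarrow> 'a::comm_ring_1 mpoly \<Rightarrow> 'a mpoly" where
  "vswap i j = push (Poly_Mapping.map_key (transpose i j)) (\<lambda>x. x)"

interpretation vswap: push_hom
  "Poly_Mapping.map_key (transpose i j) :: (nat \<Rightarrow>\<^sub>0 nat) \<Rightarrow> (nat \<Rightarrow>\<^sub>0 nat)" "\<lambda>x. x" for i j :: nat
  by standard (simp_all add: map_key_plus inj_transpose)

lemmas vswap_simps = vswap.push_simps[folded vswap_def]

lemma map_key_transpose_involutory:
  "Poly_Mapping.map_key (transpose i j) (Poly_Mapping.map_key (transpose i j) k) = k"
  by (rule poly_mapping_eqI) (simp add: map_key.rep_eq inj_transpose)

lemma vswap_mvar: "vswap i j (mvar l) = mvar (transpose i j l)"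
proof -
  have "Poly_Mapping.map_key (transpose i j) (single l (1::nat)) = single (transpose i j l) 1"
    using map_key_single[OF inj_transpose, of i j "transpose i j l" 1]
    by (simp del: One_nat_def)
  then show ?thesis
    by (simp add: mvar_def vswap_simps)
qed

text \<open>The first n variables all have the same exponent in the extracted monomial, so permuting
  them fixes it.\<close>

lemma coef_vswap:
  assumes "i \<in> {1..n}" "j \<in> {1..n}"
  shows "coef n N (vswap i j p) = coef n N p"
proof -
  have "Poly_Mapping.map_key (transpose i j) (box n N) = box n N"
    using assms by (intro poly_mapping_eqI) (auto simp: map_key.rep_eq inj_transpose lookup_box transpose_def)
  moreover have "k = k'" if "Poly_Mapping.map_key (transpose i j) k = Poly_Mapping.map_key (transpose i j) k'"
    for k k' :: "nat \<Rightarrow>\<^sub>0 nat"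
    using that by (metis map_key_transpose_involutory)
  ultimately show ?thesis
    unfolding vswap_def
    by (metis (no_types, lifting) lookup_push)
qed

lemma vswap_weight:
  assumes "i \<in> {1..n}" "j \<in> {1..n}"
  shows "vswap i j (weight n a b) = weight n a b"
proof -
  have "vswap i j (weight n a b) =
      (\<Prod>l=1..n. mvar (transpose i j l) ^ a * (1 - mvar (transpose i j l)) ^ b)"
    by (simp add: weight_def vswap_simps vswap_mvar)
  also have "\<dots> = weight n a b"
    unfolding weight_def using assms
    by (intro prod.reindex_bij_witness[of _ "transpose i j" "transpose i j"]) (auto simp: transpose_def)
  finally show ?thesis .
qed

text \<open>The exponent \<open>2 * c\<close> is even, so the order within a pair is irrelevant.
  Transposing both indices and sorting the result, which is the map \<open>w\<close>, is an
  involution of \<open>pairs n\<close>.\<close>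

lemma vswap_disc:
  assumes "i \<in> {1..n}" "j \<in> {1..n}"
  shows "vswap i j (disc n c) = (disc n c :: 'a::comm_ring_1 mpoly)"
proof -
  define t where "t = transpose i j"
  define w where "w = (\<lambda>(k, l). (min (t k) (t l), max (t k) (t l)))"
  define f where "f = (\<lambda>(k, l). (mvar k - mvar l :: 'a mpoly) ^ (2 * c))"
  have w: "w s \<in> pairs n" "w (w s) = s" if "s \<in> pairs n" for s
  proof -
    obtain k l where s: "s = (k, l)" by fastforce
    with that have kl: "k < l" "k \<in> {1..n}" "l \<in> {1..n}"
      by (auto simp: pairs_def)
    moreover have "t k \<in> {1..n}" "t l \<in> {1..n}" "t k \<noteq> t l" "t (t k) = k" "t (t l) = l"
      using kl assms by (auto simp: t_def transpose_def)
    ultimately show "w s \<in> pairs n" "w (w s) = s"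
      unfolding s by (auto simp: w_def pairs_def min_def max_def)
  qed
  have "(x - y) ^ (2 * c) = (y - x) ^ (2 * c)" for x y :: "'a mpoly"
    by (simp add: power_mult power2_commute)
  then have f: "f (w s) = (mvar (t (fst s)) - mvar (t (snd s))) ^ (2 * c)" for s
    by (cases s) (auto simp: f_def w_def min_def max_def)
  have "vswap i j (disc n c) = (\<Prod>s\<in>pairs n. (mvar (t (fst s)) - mvar (t (snd s)) :: 'a mpoly) ^ (2 * c))"
    by (simp add: disc_def vswap_simps vswap_mvar case_prod_unfold t_def)
  also have "\<dots> = prod f (pairs n)"
    by (rule prod.reindex_bij_witness[of _ w w]) (simp_all add: w f)
  also have "\<dots> = disc n c"
    by (simp add: f_def disc_def)
  finally show ?thesis .
qed

lemma vswap_sel: "i \<in> {1..n} \<Longrightarrow> j \<in> {1..n} \<Longrightarrow> vswap i j (sel n a b c) = sel n a b c"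
  by (simp add: sel_def vswap_simps vswap_weight vswap_disc)

text \<open>The quotient of \<open>sel\<close> by \<open>x_1 - x_j\<close>, but only for \<open>c > 0\<close>: for \<open>c = 0\<close> the exponent is truncated to 0.\<close>

definition sel_quot :: "nat \<Rightarrow> nat \<Rightarrow> nat \<Rightarrow> nat \<Rightarrow> nat \<Rightarrow> 'a::comm_ring_1 mpoly" where
  "sel_quot n a b c j = (mvar 1 - mvar j) ^ (2 * c - 1) *
     (\<Prod>(i, l)\<in>pairs n - {(1, j)}. (mvar i - mvar l) ^ (2 * c)) * weight n a b"

lemma sel_quot_mult:
  assumes "j \<in> {2..n}" "c > 0"
  shows "(mvar 1 - mvar j) * sel_quot n a b c j = sel n a b c"
proof -
  have "disc n c = (mvar 1 - mvar j) ^ (2 * c) *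
      (\<Prod>(i, l)\<in>pairs n - {(1, j)}. (mvar i - mvar l) ^ (2 * c) :: 'a mpoly)"
    unfolding disc_def using assms
    by (subst prod.remove[of _ "(1, j)"]) (auto simp: mem_pairs)
  moreover have "(mvar 1 - mvar j :: 'a mpoly) ^ (2 * c) = (mvar 1 - mvar j) * (mvar 1 - mvar j) ^ (2 * c - 1)"
    using assms by (simp flip: power_Suc)
  ultimately show ?thesis
    by (simp add: sel_def sel_quot_def mult_ac)
qed

lemma mvar_neq: "i \<noteq> j \<Longrightarrow> mvar i \<noteq> (mvar j :: 'a::comm_ring_1 mpoly)"
  by (metis (no_types) lookup_single_eq lookup_single_not_eq mvar_def zero_neq_one)

text \<open>The product \<open>sel\<close> is symmetric and x_1 - x_j changes sign; cancelling this
  nonzero factor in a domain leaves an antisymmetric quotient.\<close>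

lemma vswap_sel_quot:
  assumes "j \<in> {2..n}" "c > 0"
  shows "vswap 1 j (sel_quot n a b c j :: 'a::idom mpoly) = - sel_quot n a b c j"
proof -
  let ?q = "sel_quot n a b c j :: 'a mpoly"
  have "(mvar j - mvar 1) * vswap 1 j ?q = vswap 1 j ((mvar 1 - mvar j) * ?q)"
    by (simp add: vswap_simps vswap_mvar)
  also have "\<dots> = (mvar 1 - mvar j) * ?q"
    unfolding sel_quot_mult[OF assms] using assms by (intro vswap_sel) auto
  also have "\<dots> = (mvar j - mvar 1) * (- ?q)"
    by (simp add: algebra_simps)
  finally have "mvar j - mvar 1 = (0 :: 'a mpoly) \<or> ?thesis"
    unfolding mult_cancel_left .
  then show ?thesis
    using mvar_neq[of j 1, where 'a='a] assms by (simp del: One_nat_def)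
qed

section \<open>Derivative of the integrand and Aomoto's relation\<close>

lemma euler_disc:
  assumes "n \<ge> 1"
  shows "euler 1 (disc n c) * weight n a b =
    of_nat (2 * c) * (\<Sum>j=2..n. mvar 1 * sel_quot n a b c j)"
proof -
  let ?f = "\<lambda>(i, j). (mvar i - mvar j :: 'a mpoly) ^ (2 * c)"
  have "euler 1 (disc n c) = (\<Sum>s\<in>pairs n. euler 1 (?f s) * (\<Prod>t\<in>pairs n - {s}. ?f t))"
    unfolding disc_def by (rule euler_prod) simp
  \<comment> \<open>A factor without x_1 has derivative 0, and in an increasing pair the index 1 can
    only come first.\<close>
  also have "\<dots> = (\<Sum>s\<in>Pair 1 ` {2..n}. euler 1 (?f s) * (\<Prod>t\<in>pairs n - {s}. ?f t))"
  proof (rule sum.mono_neutral_right)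
    show "\<forall>s\<in>pairs n - Pair 1 ` {2..n}. euler 1 (?f s) * (\<Prod>t\<in>pairs n - {s}. ?f t) = 0"
      by (auto simp: mem_pairs euler_power euler_diff euler_mvar)
  qed (auto simp: mem_pairs)
  also have "\<dots> = (\<Sum>j=2..n. of_nat (2 * c) * (mvar 1 * ((mvar 1 - mvar j) ^ (2 * c - 1) *
      (\<Prod>t\<in>pairs n - {(1, j)}. ?f t))))"
    by (subst sum.reindex)
       (auto simp: inj_on_def euler_power euler_diff euler_mvar mult_ac intro!: sum.cong)
  finally show ?thesis
    by (simp add: sel_quot_def sum_distrib_left sum_distrib_right mult_ac del: of_nat_mult)
qed

text \<open>The logarithmic derivative is a - b * x_1 / (1 - x_1); the factor 1 - x_1 clears its
  denominator.\<close>

lemma euler_weight: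
  assumes "n \<ge> 1"
  shows "(1 - mvar 1) * euler 1 (weight n a b) =
    of_nat a * ((1 - mvar 1) * weight n a b) - of_nat b * (mvar 1 * weight n a b)"
proof -
  define R :: "'a mpoly" where "R = (\<Prod>i\<in>{1..n} - {1}. mvar i ^ a * (1 - mvar i) ^ b)"
  have w: "weight n a b = mvar 1 ^ a * (1 - mvar 1) ^ b * R"
    unfolding weight_def R_def using assms by (subst prod.remove[of _ 1]) auto
  have R: "euler 1 R = 0"
    unfolding R_def
    by (rule euler_prod_eq_0) (auto simp: euler_mult euler_power euler_diff euler_mvar)
  have pow: "of_nat m * x ^ (m - 1) * x = of_nat m * x ^ m" for m and x :: "'a mpoly"
    by (cases m) (simp_all add: mult_ac)
  \<comment> \<open>The product rule with the powers abstracted: \<open>A\<close> and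
    \<open>B\<close> stand for \<open>x ^ a\<close> and \<open>(1 - x) ^ b\<close>, while
    \<open>s\<close> and \<open>t\<close> stand for their derivatives with respect to the base. By
    \<open>pow\<close> the premises hold even for exponent 0.\<close>
  have "(1 - x) * ((s * x * B + A * (t * (0 - x))) * R + A * B * 0) = p * ((1 - x) * (A * B * R)) - q * (x * (A * B * R))"
    if "s * x = p * A" "t * (1 - x) = q * B" for x p q s t A B :: "'a mpoly"
  proof -
    have "(1 - x) * ((s * x * B + A * (t * (0 - x))) * R + A * B * 0) =
        (s * x) * ((1 - x) * B * R) - (t * (1 - x)) * (x * A * R)"
      by (simp add: algebra_simps)
    then show ?thesis
      unfolding that by (simp add: algebra_simps)
  qed
  from this[OF pow pow, of "mvar 1" a b] show ?thesis
    unfolding w euler_mult R euler_power euler_diff euler_mvar euler_one by simp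
qed

lemma euler_sel:
  assumes "n \<ge> 1"
  shows "(1 - mvar 1) * euler 1 (sel n a b c) =
    of_nat a * ((1 - mvar 1) * sel n a b c) - of_nat b * (mvar 1 * sel n a b c)
    + of_nat (2 * c) * (\<Sum>j=2..n. (1 - mvar 1) * mvar 1 * sel_quot n a b c j)"
proof -
  have "(1 - mvar 1) * euler 1 (sel n a b c) = disc n c * ((1 - mvar 1) * euler 1 (weight n a b))
      + (1 - mvar 1) * (euler 1 (disc n c) * weight n a b)"
    by (simp add: sel_def euler_mult algebra_simps)
  then show ?thesis
    unfolding euler_weight[OF assms] euler_disc[OF assms]
    by (simp add: sel_def algebra_simps sum_distrib_left sum_subtractf)
qed

text \<open>The symmetrized equations are never divided by 2: the factor \<open>2 * c\<close> from
  differentiating the discriminant absorbs it, so the characteristic of the domain does not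
  matter.\<close>

lemma aomoto:
  fixes n a b c N k :: nat
  assumes k: "k \<in> {1..n}"
  defines "I \<equiv> \<lambda>k. coef n N ((\<Prod>i=1..k. mvar i) * sel n a b c :: 'a::idom mpoly)"
  shows "(of_nat a - of_nat N + of_nat ((n - k) * c)) * I (k - 1) =
    (of_nat a - of_nat N + of_nat b + 1 + of_nat ((2 * n - k - 1) * c)) * I k"
proof -
  define X :: "'a mpoly" where "X = mvar 1"
  define Y :: "'a mpoly" where "Y = (\<Prod>i=2..k. mvar i)"
  define \<Phi> :: "'a mpoly" where "\<Phi> = sel n a b c"
  define \<Psi> :: "nat \<Rightarrow> 'a mpoly" where "\<Psi> = sel_quot n a b c"
  have n: "n \<ge> 1" "1 \<in> {1..n}" using k by auto
  have Ik: "I k = coef n N (X * Y * \<Phi>)"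
  proof -
    have "(\<Prod>i=1..k. mvar i) = X * Y"
      using k by (simp add: X_def Y_def prod.atLeast_Suc_atMost numeral_2_eq_2)
    then show ?thesis by (simp add: I_def \<Phi>_def)
  qed
  \<comment> \<open>\<open>Y\<close> omits x_1 where the product in I_(k-1) omits x_k; transposing 1
    and k turns one into the other.\<close>
  have Ik1: "I (k - 1) = coef n N (Y * \<Phi>)"
  proof -
    have "vswap 1 k Y = (\<Prod>i=1..k-1. mvar i)"
      unfolding Y_def vswap_simps vswap_mvar using k
      by (intro prod.reindex_bij_witness[of _ "transpose 1 k" "transpose 1 k"])
         (auto simp: transpose_def)
    then have "vswap 1 k (Y * \<Phi>) = (\<Prod>i=1..k-1. mvar i) * sel n a b c"
      using k n by (simp add: vswap_simps vswap_sel \<Phi>_def)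
    then show ?thesis
      unfolding I_def using coef_vswap[of 1 n k "Y * \<Phi>" N] k n by simp
  qed
  have swap: "coef n N (mvar j * Y * \<Phi>) = I k" if "j \<in> {k<..n}" for j
  proof -
    have "vswap 1 j Y = Y"
      unfolding Y_def vswap_simps vswap_mvar using that
      by (intro prod.cong) (auto simp: transpose_def)
    then have "vswap 1 j (X * Y * \<Phi>) = mvar j * Y * \<Phi>"
      using that n by (simp add: vswap_simps vswap_sel vswap_mvar \<Phi>_def X_def)
    then show ?thesis
      unfolding Ik using coef_vswap[of 1 n j "X * Y * \<Phi>" N] that by simp
  qed
  define T where "T = (\<lambda>j. coef n N ((1 - X) * X * Y * \<Psi> j))"
  \<comment> \<open>For j <= k the product X * Y is symmetric in x_1 and x_j, so X * Y * \<Psi>_j is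
    antisymmetric and twice its coefficient is 0. Adding X * X * Y * \<Psi>_j to its swap restores
    the factor x_1 - x_j and gives I_k.\<close>
  have low: "of_nat (2 * c) * T j = - of_nat c * I k" if j: "j \<in> {2..k}" for j
  proof (cases "c = 0")
    case False
    then have c: "c > 0" by simp
    have jn: "j \<in> {2..n}" using j k by auto
    note q = vswap_sel_quot[OF jn c, of a b, where 'a='a, folded \<Psi>_def]
    note m = sel_quot_mult[OF jn c, of a b, where 'a='a, folded \<Psi>_def \<Phi>_def X_def]
    define Z :: "'a mpoly" where "Z = (\<Prod>i\<in>{2..k} - {j}. mvar i)"
    have Y: "Y = mvar j * Z"
      unfolding Y_def Z_def using j by (subst prod.remove[of _ j]) auto
    have Z: "vswap 1 j Z = Z"
      unfolding Z_def vswap_simps vswap_mvar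
      by (intro prod.cong) (auto simp: transpose_def)
    have cs: "coef n N (vswap 1 j p) = coef n N p" for p :: "'a mpoly"
      using jn by (intro coef_vswap) auto
    have "coef n N (X * Y * \<Psi> j) = - coef n N (X * Y * \<Psi> j)"
      by (subst cs[symmetric]) (simp add: Y X_def vswap_simps vswap_mvar Z q mult_ac del: One_nat_def)
    then have u: "2 * coef n N (X * Y * \<Psi> j) = 0"
      by simp
    have "coef n N (X * X * Y * \<Psi> j) = - coef n N (mvar j * X * Y * \<Psi> j)"
      by (subst cs[symmetric]) (simp add: Y X_def vswap_simps vswap_mvar Z q mult_ac del: One_nat_def)
    then have "2 * coef n N (X * X * Y * \<Psi> j) = coef n N (X * Y * ((X - mvar j) * \<Psi> j))"
      by (simp add: algebra_simps lookup_minus)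
    then have v: "2 * coef n N (X * X * Y * \<Psi> j) = I k"
      by (simp add: m Ik)
    have "2 * T j = 2 * coef n N (X * Y * \<Psi> j) - 2 * coef n N (X * X * Y * \<Psi> j)"
      by (simp add: T_def algebra_simps lookup_minus)
    then have "2 * T j = - I k"
      unfolding u v by simp
    then show ?thesis by (simp add: mult_ac)
  qed simp
  \<comment> \<open>For j > k the swap fixes \<open>Y\<close>. Now X and X * X are paired with x_j
    and x_j * x_j; the differences X - x_j and (X - x_j) * (X + x_j) yield I_(k-1) and 2 *
    I_k.\<close>
  have high: "of_nat (2 * c) * T j = of_nat c * (I (k - 1) - 2 * I k)" if j: "j \<in> {k<..n}" for j
  proof (cases "c = 0")
    case False
    then have c: "c > 0" by simp
    have jn: "j \<in> {2..n}" using j k by auto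
    note q = vswap_sel_quot[OF jn c, of a b, where 'a='a, folded \<Psi>_def]
    note m = sel_quot_mult[OF jn c, of a b, where 'a='a, folded \<Psi>_def \<Phi>_def X_def]
    have Y: "vswap 1 j Y = Y"
      unfolding Y_def vswap_simps vswap_mvar using j
      by (intro prod.cong) (auto simp: transpose_def)
    have cs: "coef n N (vswap 1 j p) = coef n N p" for p :: "'a mpoly"
      using jn by (intro coef_vswap) auto
    have "coef n N (X * Y * \<Psi> j) = - coef n N (mvar j * Y * \<Psi> j)"
      by (subst cs[symmetric]) (simp add: Y X_def vswap_simps vswap_mvar q mult_ac del: One_nat_def)
    then have "2 * coef n N (X * Y * \<Psi> j) = coef n N (Y * ((X - mvar j) * \<Psi> j))"
      by (simp add: algebra_simps lookup_minus)
    then have u: "2 * coef n N (X * Y * \<Psi> j) = I (k - 1)"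
      by (simp add: m Ik1 del: One_nat_def)
    have "coef n N (X * X * Y * \<Psi> j) = - coef n N (mvar j * mvar j * Y * \<Psi> j)"
      by (subst cs[symmetric]) (simp add: Y X_def vswap_simps vswap_mvar q mult_ac del: One_nat_def)
    then have "2 * coef n N (X * X * Y * \<Psi> j) =
        coef n N (X * Y * ((X - mvar j) * \<Psi> j)) + coef n N (mvar j * Y * ((X - mvar j) * \<Psi> j))"
      by (simp add: algebra_simps lookup_minus lookup_add)
    then have v: "2 * coef n N (X * X * Y * \<Psi> j) = 2 * I k"
      unfolding m swap[OF j] Ik by simp
    have "2 * T j = 2 * coef n N (X * Y * \<Psi> j) - 2 * coef n N (X * X * Y * \<Psi> j)"
      by (simp add: T_def algebra_simps lookup_minus)
    then have "2 * T j = I (k - 1) - 2 * I k"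
      unfolding u v by simp
    then show ?thesis by (simp add: mult_ac)
  qed simp
  have "(\<Sum>j=2..n. of_nat (2 * c) * T j) =
      (\<Sum>j=2..k. of_nat (2 * c) * T j) + (\<Sum>j\<in>{k<..n}. of_nat (2 * c) * T j)"
  proof -
    have "{2..n} = {2..k} \<union> {k<..n}" using k by auto
    then show ?thesis by (simp only:) (rule sum.union_disjoint, auto)
  qed
  also have "\<dots> = of_nat (k - 1) * (- of_nat c * I k) + of_nat (n - k) * (of_nat c * (I (k - 1) - 2 * I k))"
    using low high by (simp del: of_nat_mult)
  finally have S: "(\<Sum>j=2..n. of_nat (2 * c) * T j) = \<dots>" .
  \<comment> \<open>The coefficient of the Euler derivative of (1 - X) * Y * \<Phi> is now computed
    twice: by the product rule, and as N times the coefficient itself.\<close>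
  have "Y * ((1 - X) * euler 1 \<Phi>) = of_nat a * (Y * \<Phi>) - of_nat a * (X * Y * \<Phi>)
      - of_nat b * (X * Y * \<Phi>) + (\<Sum>j=2..n. of_nat (2 * c) * ((1 - X) * X * Y * \<Psi> j))"
    unfolding X_def \<Phi>_def \<Psi>_def euler_sel[OF n(1)] distrib_left right_diff_distrib sum_distrib_left
    by (simp add: algebra_simps sum_subtractf sum_distrib_left)
  moreover have "euler 1 Y = 0"
    unfolding Y_def by (rule euler_prod_eq_0) (auto simp: euler_mvar)
  then have "euler 1 ((1 - X) * Y * \<Phi>) = Y * ((1 - X) * euler 1 \<Phi>) - X * Y * \<Phi>"
    by (simp add: euler_mult euler_diff X_def euler_mvar algebra_simps)
  ultimately have "coef n N (euler 1 ((1 - X) * Y * \<Phi>)) = of_nat a * I (k - 1) - of_nat a * I k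
      - of_nat b * I k + (\<Sum>j=2..n. of_nat (2 * c) * T j) - I k"
    by (simp only: lookup_add lookup_minus lookup_of_nat_mult lookup_sum Ik Ik1 T_def)
  moreover have "coef n N (euler 1 ((1 - X) * Y * \<Phi>)) = of_nat N * (I (k - 1) - I k)"
    unfolding coef_euler[OF n(2)] Ik Ik1 by (simp add: algebra_simps lookup_minus)
  ultimately have E: "of_nat N * (I (k - 1) - I k) = of_nat a * I (k - 1) - of_nat a * I k - of_nat b * I k
      + (of_nat (k - 1) * (- of_nat c * I k) + of_nat (n - k) * (of_nat c * (I (k - 1) - 2 * I k))) - I k"
    unfolding S by simp
  have "2 * n - k - 1 = (k - 1) + 2 * (n - k)"
    using k by auto
  then have idx: "of_nat ((2 * n - k - 1) * c) = (of_nat (k - 1) + 2 * of_nat (n - k)) * (of_nat c :: 'a)"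
    by (simp only: of_nat_mult of_nat_add of_nat_numeral)
  \<comment> \<open>Collecting the terms of I_(k-1) (here \<open>x\<close>) and I_k (here
    \<open>y\<close>), with \<open>v\<close> for k - 1 and \<open>w\<close> for n - k.\<close>
  have "(a' - N' + w * c') * x = (a' - N' + b' + 1 + (v + 2 * w) * c') * y"
    if "N' * (x - y) = a' * x - a' * y - b' * y + (v * (- c' * y) + w * (c' * (x - 2 * y))) - y"
    for a' b' c' N' v w x y :: 'a
  proof -
    have "(a' - N' + w * c') * x - (a' - N' + b' + 1 + (v + 2 * w) * c') * y =
        a' * x - a' * y - b' * y + (v * (- c' * y) + w * (c' * (x - 2 * y))) - y - N' * (x - y)"
      by (simp add: algebra_simps)
    then show ?thesis
      unfolding that by simp
  qed
  from this[OF E] show ?thesis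
    by (simp only: idx of_nat_mult[of "n - k" c])
qed

text \<open>Identifies the end k = n of a round of \<open>aomoto\<close> with the start k = 0 for
  the parameter \<open>Suc a\<close>.\<close>

lemma coef_sel_shift:
  "coef n N ((\<Prod>i=1..n. mvar i) * sel n a b c) = coef n N (sel n (Suc a) b c)"
  by (simp add: sel_def weight_def prod.distrib mult_ac)

section \<open>Degree bounds, the lowest coefficient and shifts of exponents\<close>

definition deg :: "nat \<Rightarrow> (nat \<Rightarrow>\<^sub>0 nat) \<Rightarrow> nat" where
  "deg n k = (\<Sum>i=1..n. lookup k i)"

lemma deg_add: "deg n (k + l) = deg n k + deg n l"
  by (simp add: deg_def lookup_add sum.distrib)

lemma deg_box: "deg n (box n N) = n * N"
  by (simp add: deg_def lookup_box)

text \<open>\<open>R\<close> is \<open>(=)\<close> for homogeneous polynomials and \<open>(\<le>)\<close> for a lower bound on the degrees of the monomials.\<close>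

definition has_deg :: "(nat \<Rightarrow> nat \<Rightarrow> bool) \<Rightarrow> nat \<Rightarrow> nat \<Rightarrow> 'a::comm_ring_1 mpoly \<Rightarrow> bool" where
  "has_deg R n d p \<longleftrightarrow> (\<forall>k\<in>keys p. R d (deg n k))"

lemma has_deg_diff: "has_deg R n d p \<Longrightarrow> has_deg R n d q \<Longrightarrow> has_deg R n d (p - q)"
  unfolding has_deg_def by (metis diff_self in_keys_iff lookup_minus)

lemma has_deg_0: "has_deg (\<le>) n 0 p"
  by (simp add: has_deg_def)

context
  fixes R :: "nat \<Rightarrow> nat \<Rightarrow> bool"
  assumes R: "R = (=) \<or> R = (\<le>)"
begin

lemma has_deg_mult: "has_deg R n d p \<Longrightarrow> has_deg R n e q \<Longrightarrow> has_deg R n (d + e) (p * q)"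
  using keys_mult[of p q] R by (fastforce simp: has_deg_def deg_add)

lemma has_deg_one: "has_deg R n 0 1"
  using R by (auto simp: has_deg_def deg_def)

lemma has_deg_power: "has_deg R n d p \<Longrightarrow> has_deg R n (m * d) (p ^ m)"
  by (induction m) (auto intro: has_deg_one has_deg_mult)

lemma has_deg_prod: "(\<And>s. s \<in> S \<Longrightarrow> has_deg R n d (f s)) \<Longrightarrow> has_deg R n (card S * d) (\<Prod>s\<in>S. f s)"
  by (induction S rule: infinite_finite_induct) (auto intro: has_deg_one has_deg_mult)

lemma has_deg_mvar: "i \<in> {1..n} \<Longrightarrow> has_deg R n 1 (mvar i)"
  using R by (auto simp: has_deg_def mvar_def deg_def lookup_single when_def)

end

lemma pairs_Suc: "pairs (Suc n) = pairs n \<union> (\<lambda>i. (i, Suc n)) ` {1..n}"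
  by (auto simp: pairs_def)

lemma pairs_Suc_disjoint: "pairs n \<inter> (\<lambda>i. (i, Suc n)) ` {1..n} = {}"
  by (auto simp: pairs_def)

lemma card_pairs: "card (pairs n) = n choose 2"
proof (induction n)
  case 0
  have "pairs 0 = {}" by (auto simp: pairs_def)
  then show ?case by simp
next
  case (Suc n)
  have "card (pairs (Suc n)) = card (pairs n) + card ((\<lambda>i. (i, Suc n)) ` {1..n})"
    unfolding pairs_Suc using pairs_Suc_disjoint by (intro card_Un_disjoint) auto
  also have "card ((\<lambda>i. (i, Suc n)) ` {1..n}) = n"
    by (subst card_image) (auto simp: inj_on_def)
  finally show ?case
    using Suc by (simp add: numeral_2_eq_2)
qed

text \<open>Each of the n(n-1)/2 pairs contributes degree 2c. The total is that of the monomial with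
  all exponents (n-1)c.\<close>

lemma has_deg_disc: "R = (=) \<or> R = (\<le>) \<Longrightarrow> has_deg R n (n * ((n - 1) * c)) (disc n c)"
proof -
  assume R: "R = (=) \<or> R = (\<le>)"
  have "has_deg R n ((2 * c) * 1) ((mvar i - mvar j) ^ (2 * c))" if "(i, j) \<in> pairs n" for i j
    using that by (intro has_deg_power has_deg_diff has_deg_mvar R) (auto simp: mem_pairs)
  then have "has_deg R n (card (pairs n) * (2 * c)) (disc n c)"
    unfolding disc_def by (intro has_deg_prod R) auto
  moreover have "2 * (n choose 2) = n * (n - 1)"
    by (cases n) (simp_all add: choose_two)
  then have "card (pairs n) * (2 * c) = n * ((n - 1) * c)"
    unfolding card_pairs by (simp only: mult.assoc[symmetric] mult.commute[of _ 2])
  ultimately show ?thesis by simp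
qed

lemma has_deg_coef_eq_0: "has_deg (\<le>) n d p \<Longrightarrow> n * N < d \<Longrightarrow> coef n N p = 0"
  unfolding has_deg_def by (metis deg_box in_keys_iff not_le)

lemma coef_sel_lowest:
  assumes "n \<ge> 1"
  shows "coef n ((n - 1) * c) (sel n 0 b c) = coef n ((n - 1) * c) (disc n c :: 'a::comm_ring_1 mpoly)"
proof -
  \<comment> \<open>\<open>J\<close> describes the polynomials congruent to 1 modulo terms of
    positive degree. The weight with a = 0 is one of them, and its other terms push the discriminant
    beyond the degree of the extracted monomial.\<close>
  define J where "J = (\<lambda>p :: 'a mpoly. has_deg (\<le>) n 1 (p - 1))"
  have J_mult: "J (p * q)" if "J p" "J q" for p q
  proof -
    have eq: "p * q - 1 = (p - 1) * (q - 1) + ((p - 1) - (1 - q))"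
      by (simp add: algebra_simps)
    have "has_deg (\<le>) n 1 (r + s)" if "has_deg (\<le>) n 1 r" "has_deg (\<le>) n 1 s" for r s :: "'a mpoly"
      using that keys_add[of r s] by (auto simp: has_deg_def)
    moreover have "has_deg (\<le>) n 1 (1 - q)"
      using has_deg_diff[of "(\<le>)" n 1 0 "q - 1"] that by (simp add: J_def has_deg_def)
    moreover have "has_deg (\<le>) n 1 ((p - 1) * (q - 1))"
      using has_deg_mult[of "(\<le>)" n 1 "p - 1" 0 "q - 1"] that by (simp add: J_def has_deg_0)
    ultimately show ?thesis
      using that unfolding J_def eq by (blast intro: has_deg_diff)
  qed
  have J_1: "J 1"
    by (simp add: J_def has_deg_def)
  have J_power: "J (p ^ m)" if "J p" for p m
    using that by (induction m) (auto intro: J_mult J_1)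
  have J_prod: "(\<And>s. s \<in> S \<Longrightarrow> J (f s)) \<Longrightarrow> J (\<Prod>s\<in>S. f s)" for S :: "nat set" and f
    by (induction S rule: infinite_finite_induct) (auto intro: J_mult J_1)
  have "J (1 - mvar i)" if "i \<in> {1..n}" for i
    using has_deg_diff[of "(\<le>)" n 1 0 "mvar i"] has_deg_mvar[of "(\<le>)" i n] that
    by (simp add: J_def has_deg_def)
  then have "J (weight n 0 b)"
    unfolding weight_def by (intro J_prod) (simp add: J_power)
  then have "has_deg (\<le>) n (n * ((n - 1) * c) + 1) (disc n c * (weight n 0 b - 1) :: 'a mpoly)"
    by (intro has_deg_mult has_deg_disc) (simp_all add: J_def)
  then have "coef n ((n - 1) * c) (disc n c * (weight n 0 b - 1) :: 'a mpoly) = 0"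
    by (rule has_deg_coef_eq_0) simp
  then show ?thesis
    by (simp add: sel_def algebra_simps lookup_minus)
qed

lemma lookup_single_mult: "lookup (single e 1 * p) (e + k) = lookup p k"
  for p :: "'a::comm_ring_1 mpoly"
  by (induction p rule: poly_mapping_induct)
     (simp_all add: mult_single lookup_single when_def distrib_left lookup_add)

lemma sel_eq_single_mult: "sel n a b c = single (box n a) 1 * sel n 0 b c"
proof -
  have pow: "mvar i ^ a = single (single i a) 1" for i
    by (induction a) (simp_all add: mvar_def mult_single flip: single_add)
  have "(\<Prod>i\<in>A. single (single i a) 1) = single (\<Sum>i\<in>A. single i a) (1 :: 'a)" for A
    by (induction A rule: infinite_finite_induct) (simp_all add: mult_single)
  then have "(\<Prod>i=1..n. mvar i ^ a) = single (box n a) (1 :: 'a)"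
    by (simp add: pow box_def)
  then show ?thesis
    by (simp add: sel_def weight_def prod.distrib mult_ac)
qed

text \<open>The powers of x_i with exponent a form a single monomial; removing it reduces
  coefficient computations to a = 0.\<close>

lemma coef_sel_add: "coef n (a + N) (sel n a b c) = coef n N (sel n 0 b c)"
proof -
  have "box n (a + N) = box n a + box n N"
    by (rule poly_mapping_eqI) (simp add: lookup_add lookup_box)
  then show ?thesis
    by (simp add: sel_eq_single_mult[of n a] lookup_single_mult)
qed

text \<open>Every monomial of \<open>sel\<close> has degree at least n * (a + (n-1)c), which exceeds
  the degree n * N of the extracted one.\<close>

lemma coef_sel_eq_0:
  assumes "n \<ge> 1" "N < a + (n - 1) * c"
  shows "coef n N (p * sel n a b c) = 0"
proof -
  have "has_deg (\<le>) n (0 + (n * ((n - 1) * c) + card {1..n} * (a * 1 + 0)))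
      (p * (disc n c * weight n a b))"
    unfolding weight_def
    by (intro has_deg_mult has_deg_disc has_deg_0 has_deg_prod has_deg_power has_deg_mvar) simp_all
  moreover have "n * N < n * ((n - 1) * c) + n * a"
    using assms by (simp flip: distrib_left add: add.commute)
  ultimately show ?thesis
    by (intro has_deg_coef_eq_0) (simp_all add: sel_def)
qed

text \<open>Telescoping without division, so that vanishing factors need no separate
  treatment.\<close>

lemma chain_prod:
  fixes u v I :: "nat \<Rightarrow> 'a::comm_ring_1"
  assumes "\<And>k. k \<in> {1..m} \<Longrightarrow> u k * I (k - 1) = v k * I k"
  shows "(\<Prod>k=1..m. u k) * I 0 = (\<Prod>k=1..m. v k) * I m"
  using assms
proof (induction m)
  case (Suc m)
  have "(\<Prod>k=1..Suc m. u k) * I 0 = u (Suc m) * ((\<Prod>k=1..m. u k) * I 0)"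
    by (simp add: mult_ac)
  also have "\<dots> = (\<Prod>k=1..m. v k) * (u (Suc m) * I m)"
    using Suc by (simp add: mult_ac)
  also have "u (Suc m) * I m = v (Suc m) * I (Suc m)"
    using Suc.prems[of "Suc m"] by simp
  finally show ?case by (simp add: mult_ac)
qed simp

section \<open>Morris' identity from Dyson's constant term\<close>

lemma prod_rev: "(\<Prod>k=1..n. f (n - k)) = (\<Prod>j<n. f j)" for f :: "nat \<Rightarrow> 'a::comm_monoid_mult"
  by (rule prod.reindex_bij_witness[of _ "\<lambda>j. n - j" "\<lambda>k. n - k"]) auto

lemma prod_shift: "(\<Prod>k=1..n. f (k - 1)) = (\<Prod>j<n. f j)" for f :: "nat \<Rightarrow> 'a::comm_monoid_mult"
  by (rule prod.reindex_bij_witness[of _ Suc "\<lambda>k. k - 1"]) auto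

text \<open>A full round of \<open>aomoto\<close> with a = 0 and N = \<beta> + 1 + (n-1)c. It ends
  at a = 1, which \<open>coef_sel_add\<close> trades for lowering N by one.\<close>

lemma coef_sel_step:
  assumes "\<beta> < b"
  shows "(-1) ^ n * (\<Prod>j<n. int (\<beta> + 1 + j * c)) * coef n (\<beta> + 1 + (n - 1) * c) (sel n 0 b c)
    = (\<Prod>j<n. int (b - \<beta> + j * c)) * coef n (\<beta> + (n - 1) * c) (sel n 0 b c)"
proof -
  define N where "N = \<beta> + 1 + (n - 1) * c"
  define I where "I = (\<lambda>k. coef n N ((\<Prod>i=1..k. mvar i) * sel n 0 b c :: int mpoly))"
  have "- int (\<beta> + 1 + (k - 1) * c) * I (k - 1) = int (b - \<beta> + (n - k) * c) * I k" if k: "k \<in> {1..n}" for k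
  proof -
    have "n - 1 = (k - 1) + (n - k)" "2 * n - k - 1 = (n - 1) + (n - k)"
      using k by auto
    then have "of_nat 0 - int N + int ((n - k) * c) = - int (\<beta> + 1 + (k - 1) * c)"
      and "of_nat 0 - int N + int b + 1 + int ((2 * n - k - 1) * c) = int (b - \<beta> + (n - k) * c)"
      unfolding N_def using assms by (simp_all add: algebra_simps of_nat_diff)
    then show ?thesis
      using aomoto[OF k, of 0 N c b, where 'a=int] unfolding I_def by (simp only:)
  qed
  then have "(\<Prod>k=1..n. - int (\<beta> + 1 + (k - 1) * c)) * I 0 = (\<Prod>k=1..n. int (b - \<beta> + (n - k) * c)) * I n"
    by (rule chain_prod)
  moreover have "I n = coef n (\<beta> + (n - 1) * c) (sel n 0 b c)"
    unfolding I_def coef_sel_shift using coef_sel_add[of n "Suc 0" b c "\<beta> + (n - 1) * c", where 'a=int]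
    by (simp add: N_def)
  moreover have "(\<Prod>k=1..n. - int (\<beta> + 1 + (k - 1) * c)) = (-1) ^ n * (\<Prod>j<n. int (\<beta> + 1 + j * c))"
  proof -
    have "(\<Prod>k=1..n. - int (\<beta> + 1 + (k - 1) * c)) = (-1) ^ card {1..n} * (\<Prod>k=1..n. int (\<beta> + 1 + (k - 1) * c))"
      by (rule prod_uminus)
    also have "(\<Prod>k=1..n. int (\<beta> + 1 + (k - 1) * c)) = (\<Prod>j<n. int (\<beta> + 1 + j * c))"
      by (rule prod_shift[of "\<lambda>j. int (\<beta> + 1 + j * c)" n])
    finally show ?thesis by (simp only: card_atLeastAtMost diff_Suc_1 Suc_eq_plus1 add_diff_cancel_right')
  qed
  moreover have "(\<Prod>k=1..n. int (b - \<beta> + (n - k) * c)) = (\<Prod>j<n. int (b - \<beta> + j * c))"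
    by (rule prod_rev[of "\<lambda>j. int (b - \<beta> + j * c)"])
  ultimately show ?thesis
    by (simp add: I_def N_def)
qed

lemma prod_fact_telescope:
  "fact (n * c) * (\<Prod>j<n. fact (j * c)) = (\<Prod>j<n. fact ((j + 1) * c) :: 'a::linordered_idom)"
  by (induction n) (simp_all add: mult_ac)

text \<open>Dyson's constant term of the product of (1 - x_i/x_j)^c over i \<noteq> j is (nc)!/c!^n.
  Since (x_i - x_j)^2 = - x_i x_j (1 - x_i/x_j)(1 - x_j/x_i), it appears here as the coefficient
  with all exponents (n-1)c, up to the stated sign.\<close>

definition Dyson :: "nat \<Rightarrow> nat \<Rightarrow> bool" where
  "Dyson n c \<longleftrightarrow> coef n ((n - 1) * c) (disc n c) * fact c ^ n = (-1) ^ (c * (n choose 2)) * (fact (n * c) :: int)"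

text \<open>Induction on \<open>\<beta>\<close>, the excess of the exponent over the lowest one: it
  starts at Dyson's coefficient, and each step is one full round.\<close>

lemma Morris_of_Dyson:
  assumes "n \<ge> 1" "Dyson n c" "\<beta> \<le> b"
  shows "coef n (\<beta> + (n - 1) * c) (sel n 0 b c) *
      (\<Prod>j<n. fact (b - \<beta> + j * c) * fact (\<beta> + j * c) * fact c)
    = (-1) ^ (c * (n choose 2) + n * \<beta>) * (\<Prod>j<n. fact (b + j * c) * fact ((j + 1) * c) :: int)"
  using assms(3)
proof (induction \<beta>)
  case 0
  define D :: int where "D = coef n ((n - 1) * c) (disc n c)"
  have "D * (\<Prod>j<n. fact (b + j * c) * fact (j * c) * fact c) =
      (D * fact c ^ n) * (\<Prod>j<n. fact (j * c)) * (\<Prod>j<n. fact (b + j * c))"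
    by (simp add: prod.distrib mult_ac)
  also have "D * fact c ^ n = (-1) ^ (c * (n choose 2)) * fact (n * c)"
    using assms(2) by (simp add: Dyson_def D_def)
  also have "\<dots> * (\<Prod>j<n. fact (j * c)) * (\<Prod>j<n. fact (b + j * c)) =
      (-1) ^ (c * (n choose 2)) * (\<Prod>j<n. fact (b + j * c)) * (fact (n * c) * (\<Prod>j<n. fact (j * c)))"
    by (simp add: mult_ac)
  also have "\<dots> = (-1) ^ (c * (n choose 2)) * (\<Prod>j<n. fact (b + j * c) * fact ((j + 1) * c))"
    unfolding prod_fact_telescope by (simp add: prod.distrib mult_ac)
  finally show ?case
    by (simp add: coef_sel_lowest[OF assms(1)] D_def del: One_nat_def)
next
  case (Suc \<beta>)
  define M M' :: int where "M = coef n (\<beta> + (n - 1) * c) (sel n 0 b c)"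
    and "M' = coef n (\<beta> + 1 + (n - 1) * c) (sel n 0 b c)"
  define A B :: int where "A = (\<Prod>j<n. int (\<beta> + 1 + j * c))"
    and "B = (\<Prod>j<n. int (b - \<beta> + j * c))"
  define P P' :: int where "P = (\<Prod>j<n. fact (b - \<beta> + j * c) * fact (\<beta> + j * c) * fact c)"
    and "P' = (\<Prod>j<n. fact (b - (\<beta> + 1) + j * c) * fact (\<beta> + 1 + j * c) * fact c)"
  define R :: int where "R = (\<Prod>j<n. fact (b + j * c) * fact ((j + 1) * c))"
  have step: "(-1) ^ n * A * M' = B * M"
    using coef_sel_step[of \<beta> b n c] Suc.prems by (simp add: A_def B_def M_def M'_def)
  have IH: "M * P = (-1) ^ (c * (n choose 2) + n * \<beta>) * R"
    using Suc by (simp add: M_def P_def R_def)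
  \<comment> \<open>The linear factors of the round are exactly what raises one family of factorials
    by one and lowers the other.\<close>
  have BP: "B * P' = A * P"
  proof -
    have eqs: "b - \<beta> + j * c = Suc (b - (\<beta> + 1) + j * c)" "\<beta> + 1 + j * c = Suc (\<beta> + j * c)" for j
      using Suc.prems by simp_all
    have *: "int (b - \<beta> + j * c) * (fact (b - (\<beta> + 1) + j * c) * fact (\<beta> + 1 + j * c) * fact c) =
        int (\<beta> + 1 + j * c) * (fact (b - \<beta> + j * c) * fact (\<beta> + j * c) * fact c)" for j
      unfolding eqs fact_Suc by (simp only: mult_ac)
    show ?thesis
      unfolding A_def B_def P_def P'_def prod.distrib[symmetric] by (rule prod.cong[OF refl]) (rule *)
  qed
  have "B * (M' * P') = A * M' * P"
    using BP by (simp add: mult_ac)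
  also have "\<dots> = (-1) ^ n * ((-1) ^ n * A * M') * P"
    using left_minus_one_mult_self[of n "A * M' * P"] by (simp only: mult.assoc)
  also have "\<dots> = (-1) ^ n * B * (M * P)"
    unfolding step by (simp only: mult.assoc)
  also have "\<dots> = B * ((-1) ^ (c * (n choose 2) + n * Suc \<beta>) * R)"
    unfolding IH by (simp add: power_add mult_ac)
  finally have "B * (M' * P') = B * ((-1) ^ (c * (n choose 2) + n * Suc \<beta>) * R)" .
  \<comment> \<open>Here \<beta> < b is essential: it makes \<open>B\<close> nonzero, so that
    \<open>B\<close> can be cancelled in the integers.\<close>
  moreover have "int (b - \<beta> + j * c) \<noteq> 0" for j
    unfolding of_nat_eq_0_iff using Suc.prems by simp
  then have "B \<noteq> 0"
    by (simp only: B_def prod_zero_iff finite_lessThan) blast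
  ultimately have "M' * P' = (-1) ^ (c * (n choose 2) + n * Suc \<beta>) * R"
    by simp
  then show ?case
    by (simp add: M'_def P'_def R_def)
qed

section \<open>Dyson's constant term, by setting the last variable to 1\<close>

definition drop_exp :: "nat \<Rightarrow> (nat \<Rightarrow>\<^sub>0 nat) \<Rightarrow> (nat \<Rightarrow>\<^sub>0 nat)" where
  "drop_exp i k = Poly_Mapping.update i 0 k"

interpretation eval_1: push_hom "drop_exp i" "\<lambda>x. x" for i
  by standard (auto simp: drop_exp_def lookup_update lookup_add intro!: poly_mapping_eqI)

lemma eval_1_mvar: "push (drop_exp i) (\<lambda>x. x) (mvar j) = (if i = j then 1 else mvar j)"
proof -
  have "drop_exp i (single j 1) = (if i = j then 0 else single j 1)"
    by (rule poly_mapping_eqI) (auto simp: drop_exp_def lookup_update lookup_single when_def)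
  then show ?thesis
    by (simp add: mvar_def eval_1.push_single del: One_nat_def)
qed

text \<open>The pairs containing n+1 become (x_i - 1)^(2c), which is the weight with a = 0 and b =
  2c because the exponent is even.\<close>

lemma eval_1_disc:
  "push (drop_exp (Suc n)) (\<lambda>x. x) (disc (Suc n) c) = (sel n 0 (2 * c) c :: 'a::comm_ring_1 mpoly)"
proof -
  let ?e = "push (drop_exp (Suc n)) (\<lambda>x. x) :: 'a mpoly \<Rightarrow> 'a mpoly"
  let ?f = "\<lambda>(i, j). (mvar i - mvar j :: 'a mpoly) ^ (2 * c)"
  have "?e (disc (Suc n) c) = (\<Prod>s\<in>pairs n. ?e (?f s)) * (\<Prod>s\<in>(\<lambda>i. (i, Suc n)) ` {1..n}. ?e (?f s))"
    unfolding disc_def eval_1.push_prod pairs_Suc using pairs_Suc_disjoint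
    by (intro prod.union_disjoint) auto
  also have "(\<Prod>s\<in>pairs n. ?e (?f s)) = disc n c"
    unfolding disc_def
    by (intro prod.cong) (auto simp: eval_1.push_simps eval_1_mvar mem_pairs)
  also have "(\<Prod>s\<in>(\<lambda>i. (i, Suc n)) ` {1..n}. ?e (?f s)) = (\<Prod>i=1..n. (mvar i - 1) ^ (2 * c))"
    by (subst prod.reindex) (auto simp: inj_on_def eval_1.push_simps eval_1_mvar intro!: prod.cong)
  also have "\<dots> = weight n 0 (2 * c)"
    by (simp add: weight_def power_mult power2_commute)
  finally show ?thesis by (simp add: sel_def)
qed

text \<open>By homogeneity, setting \<open>x_(n+1) = 1\<close> identifies no two monomials of \<open>disc\<close>.\<close>

lemma coef_disc_Suc:
  "coef (Suc n) (n * c) (disc (Suc n) c) = coef n (n * c) (sel n 0 (2 * c) c :: 'a::comm_ring_1 mpoly)"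
proof -
  let ?k = "box (Suc n) (n * c)"
  have drop: "drop_exp (Suc n) ?k = box n (n * c)"
    by (rule poly_mapping_eqI) (auto simp: drop_exp_def lookup_update lookup_box)
  have "k = ?k" if "k \<in> keys (disc (Suc n) c :: 'a mpoly)" "drop_exp (Suc n) k = drop_exp (Suc n) ?k" for k
  proof (rule poly_mapping_eqI)
    fix i
    have other: "lookup k j = lookup ?k j" if "j \<noteq> Suc n" for j
      using \<open>drop_exp (Suc n) k = _\<close> that
      by (metis drop_exp_def lookup_update)
    have "has_deg (=) (Suc n) (Suc n * (n * c)) (disc (Suc n) c :: 'a mpoly)"
      by (metis diff_Suc_1 has_deg_disc)
    then have "deg (Suc n) k = deg (Suc n) ?k"
      using that(1) unfolding has_deg_def deg_box by metis
    then have "lookup k (Suc n) = lookup ?k (Suc n)"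
      by (simp add: deg_def other)
    with other show "lookup k i = lookup ?k i" by metis
  qed
  then have "lookup (push (drop_exp (Suc n)) (\<lambda>x. x) (disc (Suc n) c)) (drop_exp (Suc n) ?k) =
      lookup (disc (Suc n) c :: 'a mpoly) ?k"
    by (intro lookup_push) auto
  then show ?thesis
    by (simp add: drop eval_1_disc)
qed

lemma Dyson_identity: "n \<ge> 1 \<Longrightarrow> Dyson n c"
proof (induction n rule: nat_induct_at_least)
  case base
  have "pairs 1 = {}" by (auto simp: pairs_def)
  moreover have "box 1 0 = 0" by (simp add: box_def)
  ultimately show ?case by (simp add: Dyson_def disc_def numeral_2_eq_2)
next
  case (Suc n)
  define D :: int where "D = coef (Suc n) (n * c) (disc (Suc n) c)"
  define Q :: int where "Q = (\<Prod>j<n. fact ((j + 1) * c))"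
  define s :: int where "s = (-1) ^ (c * (Suc n choose 2))"
  have eqs: "c + (n - 1) * c = n * c" "2 * c - c = c" "c * (n choose 2) + n * c = c * (Suc n choose 2)"
    using Suc.hyps by (cases n; simp add: numeral_2_eq_2 algebra_simps)+
  have le: "c \<le> 2 * c" by simp
  have eqs': "c + j * c = (j + 1) * c" "2 * c + j * c = (j + 2) * c" for j
    by (simp_all add: algebra_simps)
  \<comment> \<open>Morris' identity in n variables with b = 2c and \<beta> = c, since the exponent
    n * c is c above the lowest one.\<close>
  have "D * (\<Prod>j<n. fact ((j + 1) * c) * fact ((j + 1) * c) * fact c)
      = s * (\<Prod>j<n. fact ((j + 2) * c) * fact ((j + 1) * c))"
    using Morris_of_Dyson[OF Suc.hyps Suc.IH, of c "2 * c", OF le]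
    unfolding D_def s_def coef_disc_Suc eqs unfolding eqs' .
  then have "D * (Q * Q * fact c ^ n) = s * ((\<Prod>j<n. fact ((j + 2) * c)) * Q)"
    by (simp only: Q_def prod.distrib prod_constant card_lessThan)
  then have "Q * (D * Q * fact c ^ n) = Q * (s * (\<Prod>j<n. fact ((j + 2) * c)))"
    by (simp only: mult_ac)
  have "Q \<noteq> 0" by (simp add: Q_def)
  note cancel = mult_left_cancel[OF this, THEN iffD1]
  have DQ: "D * Q * fact c ^ n = s * (\<Prod>j<n. fact ((j + 2) * c))"
    by (rule cancel) fact
  \<comment> \<open>Completing the product by its missing first factor c! and splitting off the last
    factor exposes another \<open>Q\<close> to cancel.\<close>
  have "(\<Prod>j<n. fact ((j + 2) * c)) * fact c = (\<Prod>j<Suc n. fact ((j + 1) * c) :: int)"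
    unfolding prod.lessThan_Suc_shift by (simp add: mult.commute)
  also have "\<dots> = Q * fact (Suc n * c)"
    unfolding Q_def prod.lessThan_Suc by (simp only: Suc_eq_plus1)
  finally have "(D * Q * fact c ^ n) * fact c = s * (Q * fact (Suc n * c))"
    unfolding DQ by (simp only: mult.assoc)
  then have "Q * (D * fact c ^ Suc n) = Q * (s * fact (Suc n * c))"
    by (simp only: power_Suc mult_ac)
  then have "D * fact c ^ Suc n = s * fact (Suc n * c)"
    by (rule cancel)
  then show ?case
    by (simp only: Dyson_def D_def s_def diff_Suc_1)
qed

section \<open>Reduction modulo p and factorials\<close>

interpretation mod_p: push_hom "\<lambda>k :: nat \<Rightarrow>\<^sub>0 nat. k" "of_int :: int \<Rightarrow> 'p::prime_card mod_ring"
  by standard simp_all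

lemma coef_sel_of_int:
  "coef n N (sel n a b c :: 'p::prime_card mod_ring mpoly) = of_int (coef n N (sel n a b c))"
proof -
  have mvar: "push (\<lambda>k. k) of_int (mvar i) = (mvar i :: 'p mod_ring mpoly)" for i
    by (simp add: mvar_def mod_p.push_single)
  have "push (\<lambda>k. k) of_int (sel n a b c) = (sel n a b c :: 'p mod_ring mpoly)"
    by (simp add: sel_def disc_def weight_def mod_p.push_simps mvar case_prod_unfold)
  then show ?thesis
    using lookup_push[of "sel n a b c" "\<lambda>k. k" "box n N" "of_int :: int \<Rightarrow> 'p mod_ring"] by simp
qed

lemma of_nat_mod_ring_eq_0_iff: "of_nat x = (0 :: 'p::prime_card mod_ring) \<longleftrightarrow> CARD('p) dvd x"
  using of_nat_0_mod_ring_dvd by (auto elim!: dvdE)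

abbreviation ofact :: "nat \<Rightarrow> 'a::semiring_1" where
  "ofact m \<equiv> of_nat (fact m)"

lemma ofact_mod_ring_eq_0_iff: "(ofact m :: 'p::prime_card mod_ring) = 0 \<longleftrightarrow> CARD('p) \<le> m"
  unfolding of_nat_mod_ring_eq_0_iff by (rule prime_dvd_fact_iff) (rule prime_card)

lemma ofact_Suc: "ofact (Suc m) = of_nat (Suc m) * ofact m"
  by (simp only: fact_Suc of_nat_mult of_nat_id)

text \<open>Wilson's theorem is the case m = 0. Moving the factor p - 1 - m = -(m + 1) from one
  factorial to the other flips the sign.\<close>

lemma ofact_mult_ofact_mod_ring:
  assumes "m < CARD('p)"
  shows "ofact (CARD('p) - 1 - m) * ofact m = ((-1) ^ (m + 1) :: 'p::prime_card mod_ring)"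
  using assms
proof (induction m)
  case 0
  have "of_int (int (fact (CARD('p) - 1))) = (of_int (- 1) :: 'p mod_ring)"
    using wilson_theorem[OF prime_card[where 'a='p]]
    by (simp only: of_int_eq_iff_cong_CHAR semiring_char_mod_ring of_nat_fact)
  then show ?case by (simp add: of_int_of_nat_eq del: of_nat_fact)
next
  case (Suc m)
  have eq: "CARD('p) - 1 - m = Suc (CARD('p) - 1 - Suc m)"
    using Suc.prems by simp
  have "of_nat (CARD('p)) = (of_nat (Suc (CARD('p) - 1 - Suc m)) + of_nat (Suc m) :: 'p mod_ring)"
    unfolding of_nat_add[symmetric] using Suc.prems by (intro arg_cong[of _ _ of_nat]) simp
  then have neg: "of_nat (Suc (CARD('p) - 1 - Suc m)) = (- of_nat (Suc m) :: 'p mod_ring)"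
    by (simp add: eq_neg_iff_add_eq_0 del: of_nat_Suc)
  have "of_nat (Suc m) * (ofact (CARD('p) - 1 - Suc m) * ofact (Suc m)) =
      of_nat (Suc m) * (- ((-1) ^ (m + 1)) :: 'p mod_ring)"
  proof -
    have "of_nat (Suc m) * (ofact (CARD('p) - 1 - Suc m) * ofact (Suc m)) =
        - of_nat (Suc m) * (- of_nat (Suc m) * ofact (CARD('p) - 1 - Suc m) * ofact m :: 'p mod_ring)"
      by (simp add: mult_ac ofact_Suc del: of_nat_Suc fact_Suc)
    also have "- of_nat (Suc m) * ofact (CARD('p) - 1 - Suc m) = (ofact (CARD('p) - 1 - m) :: 'p mod_ring)"
      unfolding eq ofact_Suc neg[symmetric] ..
    finally show ?thesis
      using Suc by (simp del: fact_Suc of_nat_Suc)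
  qed
  moreover have "of_nat (Suc m) \<noteq> (0 :: 'p mod_ring)"
    unfolding of_nat_mod_ring_eq_0_iff using Suc.prems by (auto dest: dvd_imp_le)
  ultimately have "ofact (CARD('p) - 1 - Suc m) * ofact (Suc m) = (- ((-1) ^ (m + 1)) :: 'p mod_ring)"
    unfolding mult_cancel_left by blast
  then show ?case by simp
qed

lemma sum_arith: "(\<Sum>j<n. x + j * c) = n * x + c * (n choose 2)"
  by (induction n) (simp_all add: numeral_2_eq_2 algebra_simps)

text \<open>The powers of c! are cancelled while still in the integers, because c! may vanish modulo
  p.\<close>

lemma Morris_identity_div:
  assumes "n \<ge> 1" "\<beta> \<le> b"
  shows "coef n (\<beta> + (n - 1) * c) (sel n 0 b c) * (\<Prod>j<n. fact (b - \<beta> + j * c) * fact (\<beta> + j * c))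
    = (-1) ^ (c * (n choose 2) + n * \<beta>) * (\<Prod>j<n. fact (b + j * c) * of_nat (fact ((j + 1) * c) div fact c) :: int)"
proof -
  have "fact ((j + 1) * c) = of_nat (fact ((j + 1) * c) div fact c) * (fact c :: int)" for j
  proof -
    have "fact ((j + 1) * c) = fact ((j + 1) * c) div fact c * (fact c :: nat)"
      by (simp add: fact_dvd)
    then show ?thesis by (metis of_nat_fact of_nat_mult)
  qed
  then have "(\<Prod>j<n. fact (b + j * c) * fact ((j + 1) * c)) =
      (\<Prod>j<n. fact (b + j * c) * of_nat (fact ((j + 1) * c) div fact c)) * (fact c ^ n :: int)"
    by (simp add: prod.distrib mult_ac)
  with Morris_of_Dyson[OF assms(1) Dyson_identity[OF assms(1)] assms(2), of c]
  have "(coef n (\<beta> + (n - 1) * c) (sel n 0 b c) * (\<Prod>j<n. fact (b - \<beta> + j * c) * fact (\<beta> + j * c))) * fact c ^ n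
    = ((-1) ^ (c * (n choose 2) + n * \<beta>) *
        (\<Prod>j<n. fact (b + j * c) * of_nat (fact ((j + 1) * c) div fact c))) * (fact c ^ n :: int)"
    by (simp add: prod.distrib mult_ac)
  then show ?thesis by simp
qed

section \<open>The two identities over F_p\<close>

lemma Selberg_product_eq:
  assumes "n \<ge> 1"
  shows "(Selberg_product n a b c :: 'p::prime_card mod_ring) =
    (\<Prod>j<n. of_nat (fact ((j + 1) * c) div fact c) *
      (ofact (a + j * c) * ofact (b + j * c) / ofact (a + b + (n - 1) * c + j * c + 1 - CARD('p))))"
proof -
  have idx: "a + b + (n + Suc j - 2) * c = a + b + (n - Suc 0) * c + j * c" for j
  proof -
    have "n + Suc j - 2 = (n - Suc 0) + j"
      using assms by simp
    then show ?thesis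
      by (simp only: distrib_right add.assoc)
  qed
  show ?thesis
    unfolding Selberg_product_def One_nat_def prod.atLeast1_atMost_eq idx
    by (rule prod.cong) simp_all
qed

lemma Fp_Selberg:
  assumes "n \<ge> 1" "odd (CARD('p::prime_card))"
    and lower: "CARD('p) - 1 \<le> a + b + (n - 1) * c"
    and upper: "a + b + (2 * n - 2) * c < 2 * CARD('p) - 1"
  shows "coef n (CARD('p) - 1) (sel n a b c :: 'p mod_ring mpoly) = (-1) ^ n * Selberg_product n a b c"
proof (cases "CARD('p) - 1 < a + (n - 1) * c")
  case True
  \<comment> \<open>The last factor of the product has a numerator divisible by p, and the
    coefficient is 0 for reasons of degree.\<close>
  then have "(ofact (a + (n - 1) * c) :: 'p mod_ring) = 0"
    by (simp add: ofact_mod_ring_eq_0_iff)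
  then have "\<exists>j\<in>{..<n}. of_nat (fact ((j + 1) * c) div fact c) * (ofact (a + j * c) * ofact (b + j * c) /
      ofact (a + b + (n - 1) * c + j * c + 1 - CARD('p))) = (0 :: 'p mod_ring)"
    using assms(1) by (intro bexI[of _ "n - 1"]) simp_all
  then have "Selberg_product n a b c = (0 :: 'p mod_ring)"
    unfolding Selberg_product_eq[OF assms(1)] by (intro prod_zero) simp_all
  then show ?thesis
    using coef_sel_eq_0[OF assms(1) True, of 1 b] by simp
next
  case False
  \<comment> \<open>The excess of p - 1 over the lowest exponent a + (n-1)c. The case assumption
    makes the subtractions exact, and the lower bound gives \<beta> <= b.\<close>
  define \<beta> where "\<beta> = CARD('p) - 1 - a - (n - 1) * c"
  have p: "CARD('p) \<ge> 1" by simp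
  have N: "CARD('p) - 1 = a + (\<beta> + (n - 1) * c)" and b: "\<beta> \<le> b"
    using False lower by (simp_all add: \<beta>_def)
  define M :: "'p mod_ring" where "M = coef n (CARD('p) - 1) (sel n a b c)"
  define A B W Q :: "'p mod_ring"
    where "A = (\<Prod>j<n. ofact (b - \<beta> + j * c))"
      and "B = (\<Prod>j<n. ofact (\<beta> + j * c))"
      and "W = (\<Prod>j<n. ofact (a + j * c))"
      and "Q = (\<Prod>j<n. ofact (b + j * c) * of_nat (fact ((j + 1) * c) div fact c))"
  have M: "M = of_int (coef n (\<beta> + (n - 1) * c) (sel n 0 b c))"
    unfolding M_def N coef_sel_add coef_sel_of_int ..
  have MAB: "M * (A * B) = (-1) ^ (c * (n choose 2) + n * \<beta>) * Q"
    using arg_cong[OF Morris_identity_div[OF assms(1) b, of c], of "of_int :: int \<Rightarrow> 'p mod_ring"]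
    unfolding M A_def B_def Q_def of_nat_fact[symmetric, where 'a=int]
    by (simp only: of_int_mult of_int_power of_int_prod of_int_of_nat_eq of_int_minus of_int_1 prod.distrib)
  \<comment> \<open>Reversing the order in \<open>B\<close> matches \<beta> + (n-1-j)c = p - 1 - (a
    + jc) with a + jc, so that Wilson's theorem applies to each pair.\<close>
  have BW: "B * W = (-1) ^ (n * (a + 1) + c * (n choose 2))"
  proof -
    have "B = (\<Prod>j<n. ofact (\<beta> + (n - Suc j) * c))"
      unfolding B_def by (rule prod.nat_diff_reindex[symmetric])
    also have "\<dots> = (\<Prod>j<n. ofact (CARD('p) - 1 - (a + j * c)))"
    proof (rule prod.cong)
      fix j assume "j \<in> {..<n}"
      then have "n - 1 = (n - Suc j) + j" by simp
      then have "(n - 1) * c = (n - Suc j) * c + j * c" by (simp only: distrib_right)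
      then show "ofact (\<beta> + (n - Suc j) * c) = ofact (CARD('p) - 1 - (a + j * c))"
        unfolding N by simp
    qed simp
    finally have "B * W = (\<Prod>j<n. ofact (CARD('p) - 1 - (a + j * c)) * ofact (a + j * c))"
      by (simp add: W_def prod.distrib)
    also have "\<dots> = (\<Prod>j<n. (-1) ^ (a + 1 + j * c))"
    proof (rule prod.cong)
      fix j assume "j \<in> {..<n}"
      then have "j * c \<le> (n - 1) * c" by (intro mult_right_mono) auto
      then have "a + j * c < CARD('p)" using N p by linarith
      from ofact_mult_ofact_mod_ring[OF this]
      show "ofact (CARD('p) - 1 - (a + j * c)) * ofact (a + j * c) = ((-1) ^ (a + 1 + j * c) :: 'p mod_ring)"
        by (simp add: add_ac)
    qed simp
    also have "\<dots> = (-1) ^ (n * (a + 1) + c * (n choose 2))"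
      unfolding sum_arith[symmetric] by (rule power_sum[symmetric])
    finally show ?thesis .
  qed
  \<comment> \<open>The exponents add up to n * (a + 1 + \<beta> + (n-1)c) = n * p, and p is
    odd.\<close>
  have sgn: "(-1) ^ (c * (n choose 2) + n * \<beta>) * (-1) ^ (n * (a + 1) + c * (n choose 2)) = ((-1) ^ n :: 'p mod_ring)"
  proof -
    have "2 * (n choose 2) = n * (n - 1)"
      by (cases n) (simp_all add: choose_two)
    then have "c * (n * (n - 1)) = c * (n choose 2) + c * (n choose 2)"
      by (metis distrib_left mult_2)
    then have "(c * (n choose 2) + n * \<beta>) + (n * (a + 1) + c * (n choose 2)) = n * (a + 1 + \<beta>) + c * (n * (n - 1))"
      by (simp add: algebra_simps)
    also have "\<dots> = n * (a + (\<beta> + (n - 1) * c) + 1)"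
      by (simp add: algebra_simps)
    also have "\<dots> = CARD('p) * n"
      unfolding N[symmetric] using p by (simp add: mult.commute)
    finally have "(-1) ^ (c * (n choose 2) + n * \<beta>) * (-1) ^ (n * (a + 1) + c * (n choose 2)) =
        (((-1) ^ CARD('p)) ^ n :: 'p mod_ring)"
      by (simp only: power_add[symmetric] power_mult)
    also have "(-1) ^ CARD('p) = (- 1 :: 'p mod_ring)"
      using assms(2) by simp
    finally show ?thesis .
  qed
  have "M * A * (B * W) = (-1) ^ (c * (n choose 2) + n * \<beta>) * Q * W"
    using MAB by (simp add: mult_ac)
  \<comment> \<open>\<open>B * W\<close> is a sign; multiplying by it a second time removes it on
    the left, since its square is 1.\<close>
  then have "M * A * ((B * W) * (B * W)) = ((-1) ^ (c * (n choose 2) + n * \<beta>) * (B * W)) * (Q * W)"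
    by (simp add: mult_ac)
  then have MA: "M * A = (-1) ^ n * (Q * W)"
    unfolding BW sgn by (simp flip: power_mult_distrib)
  \<comment> \<open>The largest argument b - \<beta> + (n-1)c equals a + b + (2n-2)c - (p-1), which
    the upper bound keeps below p.\<close>
  have "A \<noteq> 0"
  proof -
    have "b - \<beta> + j * c < CARD('p)" if "j < n" for j
    proof -
      have "j * c \<le> (n - 1) * c" using that by (intro mult_right_mono) auto
      moreover have "(2 * n - 2) * c = (n - 1) * c + (n - 1) * c"
        by (simp add: algebra_simps)
      ultimately show ?thesis
        using N b p upper by linarith
    qed
    then show ?thesis
      by (auto simp: A_def ofact_mod_ring_eq_0_iff not_le)
  qed
  have "Selberg_product n a b c = Q * W / A"
  proof -
    have "a + b + (n - 1) * c + j * c + 1 - CARD('p) = b - \<beta> + j * c" for j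
      using N b p by linarith
    then show ?thesis
      unfolding Selberg_product_eq[OF assms(1)] Q_def W_def A_def
      by (simp add: prod.distrib prod_dividef mult_ac)
  qed
  moreover have "M = (-1) ^ n * (Q * W / A)"
    unfolding times_divide_eq_right nonzero_eq_divide_eq[OF \<open>A \<noteq> 0\<close>] by (rule MA)
  ultimately show ?thesis
    by (simp only: M_def)
qed

lemma Fp_Aomoto:
  assumes k: "k \<in> {1..n - 1}"
    and lower: "CARD('p::prime_card) - 1 \<le> a + b + (n - 1) * c"
    and upper: "a + b + (2 * n - 2) * c < 2 * CARD('p) - 2"
  shows "coef n (CARD('p) - 1) ((\<Prod>i=1..k. mvar i) * sel n a b c :: 'p mod_ring mpoly) =
    (\<Prod>j=1..k. of_nat (a + (n - j) * c + 1) / of_nat (a + b + (2 * n - j - 1) * c + 2)) *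
    coef n (CARD('p) - 1) (sel n a b c)"
proof -
  let ?N = "CARD('p) - 1"
  define I :: "nat \<Rightarrow> 'p mod_ring"
    where "I = (\<lambda>k. coef n ?N ((\<Prod>i=1..k. mvar i) * sel n a b c))"
  define u v :: "nat \<Rightarrow> 'p mod_ring"
    where "u = (\<lambda>j. of_nat (a + (n - j) * c + 1))"
      and "v = (\<lambda>j. of_nat (a + b + (2 * n - j - 1) * c + 2))"
  have "of_nat ?N + of_nat 1 = (of_nat (CARD('p)) :: 'p mod_ring)"
    unfolding of_nat_add[symmetric] by (simp del: of_nat_card_eq_0)
  \<comment> \<open>With p - 1 read as -1, the factors of \<open>aomoto\<close> become those of the
    claim.\<close>
  then have N: "of_nat ?N = (- 1 :: 'p mod_ring)"
    by (simp add: eq_neg_iff_add_eq_0)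
  have "u j * I (j - 1) = v j * I j" if "j \<in> {1..k}" for j
  proof -
    have "j \<in> {1..n}" using that k by auto
    from aomoto[OF this, of a ?N c b, where 'a="'p mod_ring"] show ?thesis
      unfolding N by (simp add: I_def u_def v_def add_ac)
  qed
  then have chain: "(\<Prod>j=1..k. u j) * I 0 = (\<Prod>j=1..k. v j) * I k"
    by (rule chain_prod)
  \<comment> \<open>The integer lies strictly between p and 2p. The sharper upper bound of (ii)
    excludes the value 2p at j = 1.\<close>
  have "v j \<noteq> 0" if "j \<in> {1..k}" for j
  proof -
    have "(n - 1) * c \<le> (2 * n - j - 1) * c" "(2 * n - j - 1) * c \<le> (2 * n - 2) * c"
      using that k by (auto intro!: mult_right_mono)
    then have "CARD('p) < a + b + (2 * n - j - 1) * c + 2" "a + b + (2 * n - j - 1) * c + 2 < 2 * CARD('p)"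
      using lower upper by linarith+
    then have "\<not> CARD('p) dvd a + b + (2 * n - j - 1) * c + 2"
      by (auto elim!: dvdE simp: mult.commute[of "CARD('p)"])
    then show ?thesis
      unfolding v_def of_nat_mod_ring_eq_0_iff .
  qed
  then have "(\<Prod>j=1..k. v j) \<noteq> 0" by simp
  with chain have "I k = (\<Prod>j=1..k. u j / v j) * I 0"
    by (simp add: prod_dividef field_simps)
  then show ?thesis
    by (simp add: I_def u_def v_def)
qed

lemma Fp_integral_eq_coef: "Fp_integral n P = coef n (CARD('p) - 1) P" for P :: "'p::prime_card Fp_mpoly"
  by (simp add: Fp_integral_def box_def)

theorem theorem4p1:
  fixes p n a b c :: nat
  assumes "p = CARD('p::prime_card)" and "prime p" and "odd p" and "n \<ge> 1"
  shows
    "(p - 1 \<le> a + b + (n - 1) * c \<longrightarrow>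
      a + b + (2 * n - 2) * c < 2 * p - 1 \<longrightarrow>
      Fp_integral n (Selberg_integrand n a b c :: 'p Fp_mpoly) =
        (-1) ^ n * Selberg_product n a b c)
     \<and>
     (\<forall>k\<in>{1..n - 1}.
      p - 1 \<le> a + b + (n - 1) * c \<longrightarrow>
      a + b + (2 * n - 2) * c < 2 * p - 2 \<longrightarrow>
      Fp_integral n ((\<Prod>i=1..k. Var i) * Selberg_integrand n a b c :: 'p Fp_mpoly) =
        (-1) ^ n *
        (\<Prod>j=1..k. of_nat (a + (n - j) * c + 1) / of_nat (a + b + (2 * n - j - 1) * c + 2)) *
        Selberg_product n a b c)"
proof (intro conjI impI ballI)
  have Var: "Var = (mvar :: nat \<Rightarrow> 'p Fp_mpoly)"
    by (intro ext) (simp add: Var_def mvar_def)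
  have odd: "odd (CARD('p))" using assms by simp
  {
    assume "p - 1 \<le> a + b + (n - 1) * c" "a + b + (2 * n - 2) * c < 2 * p - 1"
    then show "Fp_integral n (Selberg_integrand n a b c :: 'p Fp_mpoly) =
        (-1) ^ n * Selberg_product n a b c"
      using Fp_Selberg[OF \<open>n \<ge> 1\<close> odd] assms(1)
      unfolding Fp_integral_eq_coef Selberg_integrand_eq_sel by simp
  }
  fix k assume k: "k \<in> {1..n - 1}"
    and bounds: "p - 1 \<le> a + b + (n - 1) * c" "a + b + (2 * n - 2) * c < 2 * p - 2"
  then have "a + b + (2 * n - 2) * c < 2 * p - 1" by linarith
  with bounds have "coef n (CARD('p) - 1) (sel n a b c :: 'p Fp_mpoly) = (-1) ^ n * Selberg_product n a b c"
    using Fp_Selberg[OF \<open>n \<ge> 1\<close> odd] assms(1) by simp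
  then show "Fp_integral n ((\<Prod>i=1..k. Var i) * Selberg_integrand n a b c :: 'p Fp_mpoly) =
        (-1) ^ n *
        (\<Prod>j=1..k. of_nat (a + (n - j) * c + 1) / of_nat (a + b + (2 * n - j - 1) * c + 2)) *
        Selberg_product n a b c"
    unfolding Fp_integral_eq_coef Selberg_integrand_eq_sel Var
      Fp_Aomoto[OF k bounds[unfolded assms(1)]] by (simp only: mult_ac)
qed

end
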